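(* Let $m,n,k$ be nonnegative integers with $k\le m+n$. Then $\binom{m,n}{k}$ equals the number of ternary words (words over the alphabet $\{0,1,2\}$) of length $m+n$ that have exactly $k$ letters equal to $2$ and in which none of the first $m$ letters is equal to $0$.
   Context: For nonnegative integers $m,n,k$, let $X$ be a set that is the disjoint union of blocks $X_1,\dots,X_n,Y$ with $|X_i|=2$ for $i=1,\dots,n$ and $|Y|=m$. The number $\binom{m,n}{k}$ is defined as the number of $(n+k)$-element subsets of $X$ that intersect each block $X_i$, $i=1,\dots,n$ (such subsets are called $(n+k)$-insets of $X$). *)

theory Defs
  imports Main "HOL-Library.Disjoint_Sets"
begin

definition block_decomposition ::
    "nat \<Rightarrow> nat \<Rightarrow> 'a set \<Rightarrow> (nat \<Rightarrow> 'a set) \<Rightarrow> 'a set \<Rightarrow> bool" where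
  "block_decomposition m n X B Y \<longleftrightarrow>
     X = (\<Union>i\<in>{1..n}. B i) \<union> Y \<and>
     disjoint_family_on B {1..n} \<and>
     (\<forall>i\<in>{1..n}. B i \<inter> Y = {}) \<and>
     (\<forall>i\<in>{1..n}. card (B i) = 2) \<and>
     finite Y \<and> card Y = m"

definition insets :: "nat \<Rightarrow> nat \<Rightarrow> 'a set \<Rightarrow> (nat \<Rightarrow> 'a set) \<Rightarrow> 'a set set" where
  "insets n k X B =
     {S. S \<subseteq> X \<and> card S = n + k \<and> (\<forall>i\<in>{1..n}. S \<inter> B i \<noteq> {})}"

text \<open>
  The number \<open>binom(m,n; k)\<close>, computed in a given set \<open>X\<close> with two-element blocks
  \<open>B 1, \<dots>, B n\<close>. The dependence on \<open>m\<close> is through \<open>X\<close>, and the choice of \<open>X\<close> is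
  immaterial: results are to be stated for every \<open>block_decomposition m n X B Y\<close>.
\<close>

definition inset_number :: "nat \<Rightarrow> nat \<Rightarrow> 'a set \<Rightarrow> (nat \<Rightarrow> 'a set) \<Rightarrow> nat" where
  "inset_number n k X B = card (insets n k X B)"

definition ternary_words :: "nat \<Rightarrow> nat list set" where
  "ternary_words l = {w. set w \<subseteq> {0, 1, 2} \<and> length w = l}"

text \<open>Suitable sets exist for all \<open>m\<close> and \<open>n\<close>.\<close>

lemma block_decomposition_exists:
  "\<exists>X (B :: nat \<Rightarrow> (nat \<times> nat) set) Y. block_decomposition m n X B Y"
proof -
  let ?B = "\<lambda>i :: nat. {(i, 0), (i, 1 :: nat)}"
  let ?Y = "Pair (0 :: nat) ` {..<m}"
  have "block_decomposition m n ((\<Union>i\<in>{1..n}. ?B i) \<union> ?Y) ?B ?Y"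
    by (auto simp: block_decomposition_def disjoint_family_on_def card_image inj_on_def)
  then show ?thesis by blast
qed

end

theory Submission
  imports Defs
begin

text \<open>
  Number the positions of a word by \<open>j < m + n\<close>. The idea is to give every element of \<open>Y\<close> a
  fictitious partner that belongs to every set under consideration. The block structure then
  becomes uniform: there are \<open>m + n\<close> pairs, one for each position \<open>j\<close>, consisting of a point \<open>p j\<close>
  and a partner \<open>q j\<close>, where the first \<open>m\<close> partners are fictitious and the last \<open>n\<close> pairs are the
  blocks \<open>B i\<close>. An inset contains at least one point of each pair, so it amounts to two sets of
  positions \<open>P\<close> and \<open>Q\<close> (where the point, respectively the partner, is present) with union
  \<open>{..<m + n}\<close> and with \<open>{..<m} \<subseteq> Q\<close>; this is \<open>card_insets_eq_card_covers\<close>. Reading \<open>0\<close> as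
  ``only the point'', \<open>1\<close> as ``only the partner'' and \<open>2\<close> as ``both'' turns the pairs
  \<open>(P, Q)\<close> into words, and \<open>{..<m} \<subseteq> Q\<close> says that no letter before position \<open>m\<close> is \<open>0\<close>; this is
  \<open>card_words_eq_card_covers\<close>.

  The cardinalities match because the letters \<open>2\<close> sit exactly at the positions in \<open>P \<inter> Q\<close>, so
  there are \<open>card P + card Q - (m + n)\<close> of them, while the inset has
  \<open>card P + card Q - m\<close> elements.
\<close>

section \<open>Words as pairs of sets of positions\<close>

definition covers :: "nat \<Rightarrow> nat \<Rightarrow> nat \<Rightarrow> (nat set \<times> nat set) set" where
  "covers m n k = {(P, Q). P \<union> Q = {..<m + n} \<and> {..<m} \<subseteq> Q \<and> card (P \<inter> Q) = k}"

text \<open>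
  A letter of the alphabet \<open>{0, 1, 2}\<close> is determined by whether it differs from \<open>1\<close> and whether
  it differs from \<open>0\<close>, and the only combination that cannot occur is failing both; hence words
  correspond to pairs of sets that cover all positions.
\<close>

lemma card_words_eq_card_covers:
  "card {w \<in> ternary_words (m + n). count_list w 2 = k \<and> (\<forall>i<m. w ! i \<noteq> 0)}
    = card (covers m n k)"
proof -
  let ?W = "{w \<in> ternary_words (m + n). count_list w 2 = k \<and> (\<forall>i<m. w ! i \<noteq> 0)}"
  let ?F = "\<lambda>w :: nat list. ({j. j < m + n \<and> w ! j \<noteq> 1}, {j. j < m + n \<and> w ! j \<noteq> 0})"
  let ?G = "\<lambda>(P, Q). map (\<lambda>j. if j \<notin> P then 1 else if j \<notin> Q then 0 else 2 :: nat) [0..<m + n]"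
  have letter: "w ! j \<in> {0, 1, 2}" if "w \<in> ternary_words l" "j < l" for w l j
    using that nth_mem unfolding ternary_words_def by blast
  have G_letters: "?G (P, Q) ! j \<noteq> 1 \<longleftrightarrow> j \<in> P" "?G (P, Q) ! j \<noteq> 0 \<longleftrightarrow> j \<in> Q"
      "2 = ?G (P, Q) ! j \<longleftrightarrow> j \<in> P \<inter> Q"
    if "P \<union> Q = {..<m + n}" "j < m + n" for P Q j
  proof -
    have "j \<in> P \<union> Q" using that by simp
    then show "?G (P, Q) ! j \<noteq> 1 \<longleftrightarrow> j \<in> P" "?G (P, Q) ! j \<noteq> 0 \<longleftrightarrow> j \<in> Q"
      "2 = ?G (P, Q) ! j \<longleftrightarrow> j \<in> P \<inter> Q"
      using that(2) by auto
  qed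
  have restrict: "{j. j < m + n \<and> R j} = A"
    if "A \<subseteq> {..<m + n}" "\<And>j. j < m + n \<Longrightarrow> R j \<longleftrightarrow> j \<in> A" for R A
    using that by blast
  have "bij_betw ?F ?W (covers m n k)"
  proof (rule bij_betw_byWitness[where f' = ?G])
    show "\<forall>w\<in>?W. ?G (?F w) = w"
    proof
      fix w assume "w \<in> ?W"
      then have w: "w \<in> ternary_words (m + n)" and len: "length w = m + n"
        by (auto simp: ternary_words_def)
      show "?G (?F w) = w"
      proof (rule nth_equalityI)
        fix j assume "j < length (?G (?F w))"
        then have "j < m + n" by simp
        then show "?G (?F w) ! j = w ! j"
          using letter[OF w, of j] by auto
      qed (simp add: len)
    qed
    show "\<forall>PQ\<in>covers m n k. ?F (?G PQ) = PQ"
    proof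
      fix PQ assume "PQ \<in> covers m n k"
      then obtain P Q where PQ: "PQ = (P, Q)" and un: "P \<union> Q = {..<m + n}"
        by (auto simp: covers_def)
      have "P \<subseteq> {..<m + n}" "Q \<subseteq> {..<m + n}" by (simp_all flip: un)
      then have "{j. j < m + n \<and> ?G (P, Q) ! j \<noteq> 1} = P"
        and "{j. j < m + n \<and> ?G (P, Q) ! j \<noteq> 0} = Q"
        using restrict G_letters(1,2)[OF un] by presburger+
      then show "?F (?G PQ) = PQ" unfolding PQ by blast
    qed
    show "?F ` ?W \<subseteq> covers m n k"
    proof
      fix PQ assume "PQ \<in> ?F ` ?W"
      then obtain w where PQ: "PQ = ?F w" and w: "w \<in> ?W" by blast
      then have len: "length w = m + n" and tw: "w \<in> ternary_words (m + n)"
        and cnt: "count_list w 2 = k" and nz: "\<forall>i<m. w ! i \<noteq> 0"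
        by (auto simp: ternary_words_def)
      have "w ! j \<noteq> 1 \<and> w ! j \<noteq> 0 \<longleftrightarrow> 2 = w ! j" if "j < m + n" for j
        using letter[OF tw that] by auto
      then have "fst PQ \<inter> snd PQ = {j. j < length w \<and> 2 = w ! j}"
        unfolding PQ len by auto
      then have "card (fst PQ \<inter> snd PQ) = k"
        using cnt by (simp add: count_list_eq_length_filter length_filter_conv_card)
      then show "PQ \<in> covers m n k"
        using nz by (auto simp: covers_def PQ)
    qed
    show "?G ` covers m n k \<subseteq> ?W"
    proof
      fix w assume "w \<in> ?G ` covers m n k"
      then obtain P Q where w: "w = ?G (P, Q)" and PQ: "(P, Q) \<in> covers m n k" by auto
      from PQ have un: "P \<union> Q = {..<m + n}" and sub: "{..<m} \<subseteq> Q" and k: "card (P \<inter> Q) = k"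
        by (auto simp: covers_def)
      have len: "length w = m + n" by (simp add: w)
      have "P \<inter> Q \<subseteq> {..<m + n}" unfolding un[symmetric] by blast
      then have "{j. j < m + n \<and> 2 = w ! j} = P \<inter> Q"
        unfolding w by (rule restrict) (rule G_letters(3)[OF un])
      then have "count_list w 2 = k"
        using k by (simp add: count_list_eq_length_filter length_filter_conv_card len)
      moreover have "w ! i \<noteq> 0" if "i < m" for i
        unfolding w using that sub G_letters(2)[OF un, of i] by auto
      moreover have "w \<in> ternary_words (m + n)"
        by (auto simp: w ternary_words_def)
      ultimately show "w \<in> ?W" by blast
    qed
  qed
  then show ?thesis by (rule bij_betw_same_card)
qed

section \<open>Insets as pairs of sets of positions\<close>

text \<open>
  This numbers the elements of \<open>X\<close> by word positions: the first \<open>m\<close> points enumerate \<open>Y\<close>, and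
  position \<open>j \<ge> m\<close> belongs to block \<open>Suc (j - m)\<close>, because blocks are numbered from \<open>1\<close>. The real
  partners are those at positions \<open>{m..<m + n}\<close>.
\<close>

lemma block_decomposition_pairs:
  assumes "block_decomposition m n X B Y"
  obtains p q where
    "inj_on p {..<m + n}" "inj_on q {m..<m + n}"
    "p ` {..<m + n} \<inter> q ` {m..<m + n} = {}"
    "X = p ` {..<m + n} \<union> q ` {m..<m + n}"
    "\<And>j. j \<in> {m..<m + n} \<Longrightarrow> B (Suc (j - m)) = {p j, q j}"
proof -
  have X: "X = (\<Union>i\<in>{1..n}. B i) \<union> Y"
    and disj: "\<And>i i'. i \<in> {1..n} \<Longrightarrow> i' \<in> {1..n} \<Longrightarrow> i \<noteq> i' \<Longrightarrow> B i \<inter> B i' = {}"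
    and BY: "\<And>i. i \<in> {1..n} \<Longrightarrow> B i \<inter> Y = {}"
    and two: "\<And>i. i \<in> {1..n} \<Longrightarrow> card (B i) = 2"
    and Y: "finite Y" "card Y = m"
    using assms unfolding block_decomposition_def disjoint_family_on_def by blast+
  obtain h where h: "bij_betw h {..<m} Y"
    using ex_bij_betw_nat_finite[OF Y(1)] Y(2) by (auto simp: atLeast0LessThan)
  have "\<forall>i\<in>{1..n}. \<exists>x y. B i = {x, y} \<and> x \<noteq> y"
    using two by (auto simp: card_2_iff)
  then obtain a b where ab: "\<And>i. i \<in> {1..n} \<Longrightarrow> B i = {a i, b i} \<and> a i \<noteq> b i"
    by metis
  define p where "p j = (if j < m then h j else a (Suc (j - m)))" for j
  define q where "q j = b (Suc (j - m))" for j
  have idx: "Suc (j - m) \<in> {1..n}" if "j \<in> {m..<m + n}" for j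
    using that by auto
  have block: "B (Suc (j - m)) = {p j, q j}" "p j \<noteq> q j" if "j \<in> {m..<m + n}" for j
    using that ab[OF idx[OF that]] by (auto simp: p_def q_def)
  have pY: "p j \<in> Y" if "j < m" for j
    using that h by (auto simp: p_def bij_betw_def)
  have apart: "{p j, q j} \<inter> {p j', q j'} = {}"
    if "j \<in> {m..<m + n}" "j' \<in> {m..<m + n}" "j \<noteq> j'" for j j'
  proof -
    have "Suc (j - m) \<noteq> Suc (j' - m)" using that by auto
    then show ?thesis
      using disj[OF idx[OF that(1)] idx[OF that(2)]] block(1)[OF that(1)] block(1)[OF that(2)]
      by simp
  qed
  have off: "{p j, q j} \<inter> Y = {}" if "j \<in> {m..<m + n}" for j
    using BY[OF idx[OF that]] block(1)[OF that] by simp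
  have inj_pY: "inj_on p {..<m}"
    using h by (auto simp: p_def bij_betw_def inj_on_def)
  have inj_p: "inj_on p {..<m + n}"
  proof (rule inj_onI)
    fix j j' assume jj: "j \<in> {..<m + n}" "j' \<in> {..<m + n}" "p j = p j'"
    consider "j < m" "j' < m" | "j < m" "\<not> j' < m" | "\<not> j < m" "j' < m"
      | "\<not> j < m" "\<not> j' < m" by blast
    then show "j = j'"
    proof cases
      case 1 then show ?thesis using inj_pY jj by (auto simp: inj_on_def)
    next
      case 2 then show ?thesis using pY[of j] off[of j'] jj by auto
    next
      case 3 then show ?thesis using pY[of j'] off[of j] jj by auto
    next
      case 4 then show ?thesis using apart[of j j'] jj by auto
    qed
  qed
  have inj_q: "inj_on q {m..<m + n}"
    using apart by (fastforce simp: inj_on_def)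
  have "p j \<noteq> q j'" if "j < m + n" "j' \<in> {m..<m + n}" for j j'
  proof (cases "j < m")
    case True then show ?thesis using pY[of j] off[OF that(2)] by auto
  next
    case False then show ?thesis
      using that block(2)[of j] apart[of j j'] by (cases "j = j'") auto
  qed
  then have pq: "p ` {..<m + n} \<inter> q ` {m..<m + n} = {}" by auto
  have "(\<Union>i\<in>{1..n}. B i) = (\<Union>j\<in>{m..<m + n}. B (Suc (j - m)))"
  proof -
    have "{1..n} = (\<lambda>j. Suc (j - m)) ` {m..<m + n}"
    proof
      show "{1..n} \<subseteq> (\<lambda>j. Suc (j - m)) ` {m..<m + n}"
      proof
        fix i assume "i \<in> {1..n}"
        then show "i \<in> (\<lambda>j. Suc (j - m)) ` {m..<m + n}"
          by (intro image_eqI[of _ _ "m + (i - 1)"]) auto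
      qed
    qed auto
    then show ?thesis by simp
  qed
  also have "\<dots> = p ` {m..<m + n} \<union> q ` {m..<m + n}"
    using block(1) by auto
  moreover have "Y = p ` {..<m}"
    using h by (auto simp: p_def bij_betw_def)
  moreover have "{..<m + n} = {..<m} \<union> {m..<m + n}"
    by auto
  ultimately have "X = p ` {..<m + n} \<union> q ` {m..<m + n}"
    unfolding X by (simp add: image_Un Un_ac)
  then show thesis by (rule that[OF inj_p inj_q pq _ block(1)])
qed

text \<open>
  An inset is recovered from a pair \<open>(P, Q)\<close> by dropping the \<open>m\<close> fictitious partners, which all
  belong to \<open>Q\<close>. The sizes agree by inclusion and exclusion:
  \<open>card P + card (Q - {..<m}) = (card (P \<inter> Q) + (m + n)) - m = n + k\<close>.
\<close>

lemma card_insets_eq_card_covers: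
  assumes "block_decomposition m n X B Y"
  shows "card (insets n k X B) = card (covers m n k)"
proof -
  obtain p q where
    inj_p: "inj_on p {..<m + n}" and inj_q: "inj_on q {m..<m + n}"
    and disj: "p ` {..<m + n} \<inter> q ` {m..<m + n} = {}"
    and X: "X = p ` {..<m + n} \<union> q ` {m..<m + n}"
    and block: "\<And>j. j \<in> {m..<m + n} \<Longrightarrow> B (Suc (j - m)) = {p j, q j}"
    using block_decomposition_pairs[OF assms] by metis
  have hits: "(\<forall>i\<in>{1..n}. S \<inter> B i \<noteq> {}) \<longleftrightarrow> (\<forall>j\<in>{m..<m + n}. p j \<in> S \<or> q j \<in> S)" for S
  proof
    assume L: "\<forall>i\<in>{1..n}. S \<inter> B i \<noteq> {}"
    show "\<forall>j\<in>{m..<m + n}. p j \<in> S \<or> q j \<in> S"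
    proof
      fix j assume j: "j \<in> {m..<m + n}"
      then have "S \<inter> B (Suc (j - m)) \<noteq> {}" using L by auto
      then show "p j \<in> S \<or> q j \<in> S" using block[OF j] by auto
    qed
  next
    assume R: "\<forall>j\<in>{m..<m + n}. p j \<in> S \<or> q j \<in> S"
    show "\<forall>i\<in>{1..n}. S \<inter> B i \<noteq> {}"
    proof
      fix i assume "i \<in> {1..n}"
      then have j: "m + (i - 1) \<in> {m..<m + n}" and i: "Suc (m + (i - 1) - m) = i" by auto
      show "S \<inter> B i \<noteq> {}" using R j block[OF j] unfolding i by auto
    qed
  qed
  \<comment> \<open>The condition in the second component of \<open>?G\<close> is void for \<open>j < m\<close>, which puts the
    fictitious partners back.\<close>
  let ?F = "\<lambda>(P, Q). p ` P \<union> q ` (Q - {..<m})"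
  let ?G = "\<lambda>S. ({j. j < m + n \<and> p j \<in> S}, {j. j < m + n \<and> (m \<le> j \<longrightarrow> q j \<in> S)})"
  have parts: "P \<subseteq> {..<m + n}" "Q \<subseteq> {..<m + n}" "Q - {..<m} \<subseteq> {m..<m + n}"
    if "P \<union> Q = {..<m + n}" for P Q
  proof -
    show "P \<subseteq> {..<m + n}" "Q \<subseteq> {..<m + n}" by (simp_all flip: that)
    then show "Q - {..<m} \<subseteq> {m..<m + n}" by auto
  qed
  have p_mem: "p j \<in> ?F (P, Q) \<longleftrightarrow> j \<in> P" if "P \<union> Q = {..<m + n}" "j < m + n" for P Q j
  proof -
    have sub: "P \<subseteq> {..<m + n}" "Q - {..<m} \<subseteq> {m..<m + n}" and j: "j \<in> {..<m + n}"
      using parts[OF that(1)] that(2) by simp_all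
    have "p j \<notin> q ` (Q - {..<m})"
      using disj image_mono[OF sub(2), of q] imageI[OF j, of p] by blast
    then show ?thesis using inj_on_image_mem_iff[OF inj_p j sub(1)] by simp
  qed
  have q_mem: "q j \<in> ?F (P, Q) \<longleftrightarrow> j \<in> Q"
    if "P \<union> Q = {..<m + n}" "j \<in> {m..<m + n}" for P Q j
  proof -
    note sub = parts[OF that(1)]
    have "q j \<notin> p ` P"
      using disj image_mono[OF sub(1), of p] imageI[OF that(2), of q] by blast
    then show ?thesis
      using inj_on_image_mem_iff[OF inj_q that(2) sub(3)] that(2) by simp
  qed
  have card_F: "card (?F (P, Q)) = n + card (P \<inter> Q)"
    if "P \<union> Q = {..<m + n}" "{..<m} \<subseteq> Q" for P Q
  proof -
    note sub = parts[OF that(1)]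
    from sub have fin: "finite P" "finite Q" by (auto intro: finite_subset)
    have "p ` P \<inter> q ` (Q - {..<m}) = {}"
      using image_mono[OF sub(1), of p] image_mono[OF sub(3), of q] disj by blast
    then have "card (?F (P, Q)) = card P + card (Q - {..<m})"
      using fin inj_on_subset[OF inj_p sub(1)] inj_on_subset[OF inj_q sub(3)]
      by (simp add: card_Un_disjoint card_image)
    moreover have "card (Q - {..<m}) + m = card Q"
      using that(2) fin(2) card_mono[of Q "{..<m}"] by (simp add: card_Diff_subset)
    moreover have "card P + card Q = m + n + card (P \<inter> Q)"
      using card_Un_Int[OF fin] that(1) by simp
    ultimately show ?thesis by linarith
  qed
  have G_covers: "fst (?G S) \<union> snd (?G S) = {..<m + n}" "{..<m} \<subseteq> snd (?G S)"
    if "\<forall>j\<in>{m..<m + n}. p j \<in> S \<or> q j \<in> S" for S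
    using that by auto
  have F_G: "?F (?G S) = S" if "S \<subseteq> X" for S
    using that unfolding X by auto
  have "bij_betw ?F (covers m n k) (insets n k X B)"
  proof (rule bij_betw_byWitness[where f' = ?G])
    show "\<forall>PQ\<in>covers m n k. ?G (?F PQ) = PQ"
    proof
      fix PQ assume "PQ \<in> covers m n k"
      then obtain P Q where PQ: "PQ = (P, Q)" and un: "P \<union> Q = {..<m + n}" and sub: "{..<m} \<subseteq> Q"
        by (auto simp: covers_def)
      have "{j. j < m + n \<and> p j \<in> ?F (P, Q)} = P"
        using p_mem[OF un] un by blast
      moreover have "{j. j < m + n \<and> (m \<le> j \<longrightarrow> q j \<in> ?F (P, Q))} = Q"
      proof (rule set_eqI)
        fix j
        show "j \<in> {j. j < m + n \<and> (m \<le> j \<longrightarrow> q j \<in> ?F (P, Q))} \<longleftrightarrow> j \<in> Q"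
          using q_mem[OF un, of j] un sub by (cases "j < m") auto
      qed
      ultimately show "?G (?F PQ) = PQ" unfolding PQ by blast
    qed
    show "\<forall>S\<in>insets n k X B. ?F (?G S) = S"
      using F_G by (auto simp: insets_def)
    show "?F ` covers m n k \<subseteq> insets n k X B"
    proof
      fix S assume "S \<in> ?F ` covers m n k"
      then obtain P Q where S: "S = ?F (P, Q)" and un: "P \<union> Q = {..<m + n}"
        and sub: "{..<m} \<subseteq> Q" and k: "card (P \<inter> Q) = k"
        by (auto simp: covers_def)
      have "S \<subseteq> X" using parts[OF un] unfolding S X by auto
      moreover have "\<forall>j\<in>{m..<m + n}. p j \<in> S \<or> q j \<in> S"
      proof
        fix j assume j: "j \<in> {m..<m + n}"
        then have "j \<in> P \<or> j \<in> Q" using un by auto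
        then show "p j \<in> S \<or> q j \<in> S" using p_mem[OF un] q_mem[OF un j] j unfolding S by auto
      qed
      ultimately show "S \<in> insets n k X B"
        using card_F[OF un sub] k unfolding S insets_def hits by blast
    qed
    show "?G ` insets n k X B \<subseteq> covers m n k"
    proof
      fix PQ assume "PQ \<in> ?G ` insets n k X B"
      then obtain S where PQ: "PQ = ?G S" and S: "S \<in> insets n k X B" by blast
      have cov: "fst PQ \<union> snd PQ = {..<m + n}" "{..<m} \<subseteq> snd PQ"
        using S G_covers unfolding PQ insets_def hits by blast+
      have "?F (fst PQ, snd PQ) = S"
        using S F_G by (auto simp: PQ insets_def)
      then have "n + card (fst PQ \<inter> snd PQ) = n + k"
        using card_F[OF cov] S by (simp add: insets_def)
      then show "PQ \<in> covers m n k"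
        using cov by (simp add: covers_def case_prod_beta)
    qed
  qed
  then show ?thesis by (metis bij_betw_same_card)
qed

section \<open>Insets and words\<close>

theorem proposition6:
  fixes m n k :: nat and X Y :: "'a set" and B :: "nat \<Rightarrow> 'a set"
  assumes "block_decomposition m n X B Y"
    and "k \<le> m + n"
  shows "inset_number n k X B =
    card {w \<in> ternary_words (m + n). count_list w 2 = k \<and> (\<forall>i<m. w ! i \<noteq> 0)}"
  unfolding inset_number_def
  using card_insets_eq_card_covers[OF assms(1)] card_words_eq_card_covers by simp

end
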